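(* Let $T$ be an orientation of a caterpillar and let $P\subseteq T$ be a longest path in $T$. Then $\chi_{d}(T)\geq\chi_{d}(P)$.
   Context: A caterpillar is a finite tree in which every vertex is at distance at most one from a central path. A longest path in $T$ means a longest path of the underlying undirected tree (it need not be a directed path), and $P$ carries the orientation induced from $T$. An orientation replaces each edge by exactly one of the two possible arcs. For a vertex $v$ of a digraph $D$, $N^{+}(v)$ denotes the open out-neighborhood (in $D$), i.e. the set of vertices $w$ such that $(v,w)$ is an arc; $v$ dominates each vertex of $N^{+}(v)$. A dominator coloring of $D$ is a proper vertex coloring (adjacent vertices of the underlying graph receive different colors) such that every vertex $v$ with $N^{+}(v)\neq\emptyset$ dominates at least one color class, i.e. there is a nonempty color class contained in $N^{+}(v)$ (vertices of out-degree zero are exempt). The dominator chromatic number $\chi_{d}(D)$ is the minimum number of colors in a dominator coloring of $D$. *)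

theory Defs
  imports "Graph_Theory.Graph_Theory"
begin

text \<open>
  Undirected graphs are symmetric digraphs (\<^locale>\<open>pair_graph\<close>: finite, loop-free, symmetric).
  In such a graph every edge u-v yields the directed cycle u, v, u, so the library's \<open>forest\<close> and
  \<open>tree\<close> do not describe undirected acyclicity. A cycle of the undirected graph is a cycle with at
  least three arcs.
\<close>

definition undirected_tree :: "'a pair_pre_digraph \<Rightarrow> bool" where
  "undirected_tree G \<longleftrightarrow>
     pair_graph G \<and> Digraph_Component.connected (with_proj G) \<and>
     \<not> (\<exists>p. pre_digraph.cycle (with_proj G) p \<and> length p \<ge> 3)"

definition graph_dist :: "'a pair_pre_digraph \<Rightarrow> 'a \<Rightarrow> 'a \<Rightarrow> ereal" where
  "graph_dist G u v = wf_digraph.\<mu> (with_proj G) (\<lambda>_. 1) u v"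

definition caterpillar :: "'a pair_pre_digraph \<Rightarrow> bool" where
  "caterpillar G \<longleftrightarrow>
     undirected_tree G \<and>
     (\<exists>p. vpath p (with_proj G) \<and> (\<forall>v\<in>pverts G. \<exists>u\<in>set p. graph_dist G u v \<le> 1))"

definition longest_path :: "'a vwalk \<Rightarrow> 'a pair_pre_digraph \<Rightarrow> bool" where
  "longest_path p G \<longleftrightarrow>
     vpath p (with_proj G) \<and>
     (\<forall>q. vpath q (with_proj G) \<longrightarrow> vwalk_length q \<le> vwalk_length p)"

text \<open>
  An undirected edge is represented in \<open>G\<close> by both of its arcs; \<open>D\<close> keeps exactly one of them.
\<close>

definition orientation :: "'a pair_pre_digraph \<Rightarrow> 'a pair_pre_digraph \<Rightarrow> bool" where
  "orientation D G \<longleftrightarrow>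
     pverts D = pverts G \<and> parcs D \<subseteq> parcs G \<and>
     (\<forall>(u, v)\<in>parcs G. (u, v) \<in> parcs D \<longleftrightarrow> (v, u) \<notin> parcs D)"

text \<open>
  The vertex list \<open>p\<close> is a path of the underlying undirected graph of \<open>D\<close>; each of its edges
  is traversed by \<open>p\<close> in one direction, which need not be the direction it has in \<open>D\<close>.
\<close>

definition path_subdigraph :: "'a pair_pre_digraph \<Rightarrow> 'a vwalk \<Rightarrow> 'a pair_pre_digraph" where
  "path_subdigraph D p =
     \<lparr> pverts = set p,
       parcs = {(u, v) \<in> parcs D. (u, v) \<in> set (vwalk_arcs p) \<or> (v, u) \<in> set (vwalk_arcs p)} \<rparr>"

definition out_neighborhood :: "'a pair_pre_digraph \<Rightarrow> 'a \<Rightarrow> 'a set" where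
  "out_neighborhood D v = {w. (v, w) \<in> parcs D}"

definition color_class :: "'a pair_pre_digraph \<Rightarrow> ('a \<Rightarrow> nat) \<Rightarrow> nat \<Rightarrow> 'a set" where
  "color_class D c i = {v \<in> pverts D. c v = i}"

definition proper_coloring :: "'a pair_pre_digraph \<Rightarrow> ('a \<Rightarrow> nat) \<Rightarrow> bool" where
  "proper_coloring D c \<longleftrightarrow> (\<forall>(u, v)\<in>parcs D. c u \<noteq> c v)"

definition dominator_coloring :: "'a pair_pre_digraph \<Rightarrow> ('a \<Rightarrow> nat) \<Rightarrow> bool" where
  "dominator_coloring D c \<longleftrightarrow>
     proper_coloring D c \<and>
     (\<forall>v\<in>pverts D. out_neighborhood D v \<noteq> {} \<longrightarrow>
        (\<exists>i. color_class D c i \<noteq> {} \<and> color_class D c i \<subseteq> out_neighborhood D v))"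

definition dominator_chromatic_number :: "'a pair_pre_digraph \<Rightarrow> nat" where
  "dominator_chromatic_number D =
     (LEAST k. \<exists>c. dominator_coloring D c \<and> card (c ` pverts D) = k)"

text \<open>
  The minimum is attained: on a finite loop-free digraph an injective coloring is a
  dominator coloring.
\<close>

lemma dominator_coloring_exists:
  assumes "pair_digraph D"
  shows "\<exists>c. dominator_coloring D c"
proof -
  interpret pair_digraph D by fact
  obtain c :: "'a \<Rightarrow> nat" where c: "inj_on c (pverts D)"
    using finite_imp_inj_to_nat_seg[OF pair_finite_verts] by blast
  have "proper_coloring D c"
    unfolding proper_coloring_def
    using c by (auto dest: in_arcsD1 in_arcsD2 no_loops' inj_onD)
  moreover have "\<exists>i. color_class D c i \<noteq> {} \<and> color_class D c i \<subseteq> out_neighborhood D v"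
    if "out_neighborhood D v \<noteq> {}" for v
  proof -
    from that obtain w where w: "(v, w) \<in> parcs D" by (auto simp: out_neighborhood_def)
    then have "color_class D c (c w) = {w}"
      using c by (auto simp: color_class_def dest: in_arcsD2 inj_onD)
    then show ?thesis using w by (intro exI[of _ "c w"]) (simp add: out_neighborhood_def)
  qed
  ultimately show ?thesis unfolding dominator_coloring_def by blast
qed

lemma orientation_pair_digraph:
  assumes "pair_graph G" "orientation D G"
  shows "pair_digraph D"
proof -
  interpret pair_graph G by fact
  have V: "pverts D = pverts G" and A: "parcs D \<subseteq> parcs G"
    using assms(2) by (auto simp: orientation_def)
  show ?thesis
  proof
    fix e assume "e \<in> parcs D"
    with A have e: "e \<in> parcs G" by blast
    then show "fst e \<in> pverts D" "snd e \<in> pverts D" "fst e \<noteq> snd e"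
      using V arc_fst_in_verts arc_snd_in_verts pair_no_loops by auto
  next
    show "finite (pverts D)" using V pair_finite_verts by simp
    show "finite (parcs D)" using A pair_finite_arcs by (rule finite_subset)
  qed
qed

lemma graph_dist_le_1_iff:
  assumes "pair_graph G" "u \<in> pverts G" "v \<in> pverts G"
  shows "graph_dist G u v \<le> 1 \<longleftrightarrow> u = v \<or> (u, v) \<in> parcs G"
proof -
  interpret pair_graph G by fact
  have len: "awalk_cost (\<lambda>_. 1) q = real (length q)" for q
    by (induct q) simp_all
  show ?thesis
  proof
    assume d: "graph_dist G u v \<le> 1"
    have "\<exists>q. awalk u q v \<and> length q \<le> 1"
    proof (rule ccontr)
      assume "\<not> ?thesis"
      then have "2 \<le> ereal (awalk_cost (\<lambda>_. 1) q)" if "awalk u q v" for q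
        using that len[of q] by fastforce
      then have "2 \<le> graph_dist G u v"
        unfolding graph_dist_def \<mu>_def by (auto intro: INF_greatest)
      then have "(2::ereal) \<le> 1" using d by (rule order_trans)
      then show False by simp
    qed
    then obtain q where "awalk u q v" "length q \<le> 1" by blast
    then show "u = v \<or> (u, v) \<in> parcs G"
      by (cases q) (auto simp: awalk_simps)
  next
    assume "u = v \<or> (u, v) \<in> parcs G"
    then obtain q where q: "awalk u q v" "length q \<le> 1"
    proof
      assume "u = v" then show thesis using that[of "[]"] assms by (simp add: awalk_Nil_iff)
    next
      assume "(u, v) \<in> parcs G"
      then show thesis using that[of "[(u, v)]"] assms by (simp add: awalk_simps)
    qed
    have "graph_dist G u v \<le> ereal (awalk_cost (\<lambda>_. 1) q)"
      unfolding graph_dist_def \<mu>_def using q(1) by (auto intro: INF_lower)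
    also have "\<dots> \<le> 1" using q(2) len[of q] by (simp add: one_ereal_def)
    finally show "graph_dist G u v \<le> 1" .
  qed
qed

end

theory Submission
  imports Defs
begin

text \<open>
  A dominator coloring of \<open>T\<close>, restricted to the path \<open>P\<close>, stays proper, but a vertex \<open>v\<close> of \<open>P\<close>
  may lose the color class that it dominates: this happens when the class consists of
  out-neighbors of \<open>v\<close> outside \<open>P\<close>. Then its color is absent from \<open>P\<close>, so it can be reused without
  increasing the number of colors: give it to one out-neighbor of \<open>v\<close> on \<open>P\<close>, which becomes a
  singleton class dominated by \<open>v\<close>. Two facts about trees make this work. First, \<open>P\<close> is induced,
  so whatever part of a class remains on \<open>P\<close> is still dominated along arcs of \<open>P\<close>. Secondly, a vertex
  outside \<open>P\<close> has at most one neighbor on \<open>P\<close>, so distinct vertices \<open>v\<close> lose distinct colors, and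
  the recolored vertices are indeed singleton classes. Both hold because a chord of \<open>P\<close>, or two
  edges from \<open>P\<close> to the same outside vertex, would close a cycle
  (\<open>tree_vpath_chord\<close>, \<open>tree_vpath_outside_neighbor\<close>); the recoloring itself
  needs only these two facts about the pair of digraphs
  (\<open>dominator_chromatic_number_induced_le\<close>).
\<close>

section \<open>Dominator colorings of induced subdigraphs\<close>

lemma dominator_chromatic_number_le:
  assumes "dominator_coloring D c"
  shows "dominator_chromatic_number D \<le> card (c ` pverts D)"
  unfolding dominator_chromatic_number_def using assms by (intro Least_le) blast

lemma dominator_chromatic_number_attained:
  assumes "pair_digraph D"
  obtains c where "dominator_coloring D c" "card (c ` pverts D) = dominator_chromatic_number D"
proof -
  have "\<exists>k c. dominator_coloring D c \<and> card (c ` pverts D) = k"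
    using dominator_coloring_exists[OF assms] by blast
  then have "\<exists>c. dominator_coloring D c \<and> card (c ` pverts D) = dominator_chromatic_number D"
    unfolding dominator_chromatic_number_def by (rule LeastI_ex)
  then show ?thesis using that by blast
qed

text \<open>
  The in-neighbor condition says that the out-neighborhoods of distinct vertices of \<open>H\<close> are
  disjoint outside \<open>H\<close>; hence so are the color classes that are lost on restriction to \<open>H\<close>.
\<close>

lemma dominator_coloring_induced:
  assumes V: "pverts H \<subseteq> pverts D"
    and A: "parcs H = {(u, v) \<in> parcs D. u \<in> pverts H \<and> v \<in> pverts H}"
    and one_in: "\<And>u v x. \<lbrakk>u \<in> pverts H; v \<in> pverts H; x \<notin> pverts H;
      (u, x) \<in> parcs D; (v, x) \<in> parcs D\<rbrakk> \<Longrightarrow> u = v"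
    and c: "dominator_coloring D c"
  obtains c' where "dominator_coloring H c'" "c' ` pverts H \<subseteq> c ` pverts D"
proof -
  let ?V = "pverts H"
  define lost where "lost v i \<longleftrightarrow> color_class D c i \<noteq> {} \<and>
    color_class D c i \<subseteq> out_neighborhood D v \<and> color_class D c i \<inter> ?V = {}" for v i
  define B where "B = {v \<in> ?V. out_neighborhood H v \<noteq> {} \<and> (\<exists>i. lost v i)}"
  have "\<exists>i. lost v i" "\<exists>w. w \<in> out_neighborhood H v" if "v \<in> B" for v
    using that by (auto simp: B_def)
  then obtain col w where col: "\<And>v. v \<in> B \<Longrightarrow> lost v (col v)"
    and w: "\<And>v. v \<in> B \<Longrightarrow> w v \<in> out_neighborhood H v"
    by metis
  have col_inj: "u = v" if uv: "u \<in> B" "v \<in> B" "col u = col v" for u v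
  proof -
    obtain x where "x \<in> color_class D c (col u)" using col[OF uv(1)] by (auto simp: lost_def)
    then have "x \<notin> ?V" "(u, x) \<in> parcs D" "(v, x) \<in> parcs D"
      using col[OF uv(1)] col[OF uv(2)] uv(3) by (auto simp: lost_def out_neighborhood_def)
    then show ?thesis using one_in uv by (auto simp: B_def)
  qed
  have col_fresh: "c y \<noteq> col v" if "v \<in> B" "y \<in> ?V" for v y
    using col[OF that(1)] that(2) V by (auto simp: lost_def color_class_def)
  have col_used: "col v \<in> c ` pverts D" if "v \<in> B" for v
    using col[OF that] by (force simp: lost_def color_class_def)
  \<comment> \<open>Several vertices may select the same out-neighbor \<open>y\<close>; it receives the lost color of one of
      them, and the class \<open>{y}\<close> serves them all.\<close>
  define c' where "c' y = (if y \<in> w ` B then col (inv_into B w y) else c y)" for y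
  have singleton: "y = z" if "y \<in> w ` B" "z \<in> ?V" "c' z = c' y" for y z
  proof (cases "z \<in> w ` B")
    case True
    then have "inv_into B w z = inv_into B w y"
      using that col_inj by (simp add: c'_def inv_into_into)
    then show ?thesis using that True by (metis f_inv_into_f)
  next
    case False
    then show ?thesis
      using that col_fresh[OF inv_into_into[OF that(1)] that(2)] by (simp add: c'_def)
  qed
  have proper: "proper_coloring H c'"
    unfolding proper_coloring_def
  proof safe
    fix u v assume uv: "(u, v) \<in> parcs H" and eq: "c' u = c' v"
    then have in_V: "u \<in> ?V" "v \<in> ?V" and ne: "c u \<noteq> c v"
      using A c by (auto simp: dominator_coloring_def proper_coloring_def)
    then have "u \<notin> w ` B" "v \<notin> w ` B"
      using singleton[OF _ in_V(2) eq[symmetric]] singleton[OF _ in_V(1) eq] by blast+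
    then show False using eq ne by (simp add: c'_def)
  qed
  have selected: "\<exists>i. color_class H c' i \<noteq> {} \<and> color_class H c' i \<subseteq> out_neighborhood H v"
    if "y \<in> w ` B" "y \<in> out_neighborhood H v" for y v
  proof -
    have "y \<in> ?V" using that A by (auto simp: out_neighborhood_def)
    then have "color_class H c' (c' y) = {y}"
      using singleton[OF that(1)] by (auto simp: color_class_def)
    then show ?thesis using that(2) by (intro exI[of _ "c' y"]) simp
  qed
  have "dominator_coloring H c'"
    unfolding dominator_coloring_def
  proof (intro conjI ballI impI proper)
    fix v assume v: "v \<in> ?V" "out_neighborhood H v \<noteq> {}"
    show "\<exists>i. color_class H c' i \<noteq> {} \<and> color_class H c' i \<subseteq> out_neighborhood H v"
    proof (cases "v \<in> B")
      case True
      then show ?thesis using selected w by blast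
    next
      case False
      have "out_neighborhood D v \<noteq> {}" using v A by (auto simp: out_neighborhood_def)
      then obtain i where i: "color_class D c i \<noteq> {}" "color_class D c i \<subseteq> out_neighborhood D v"
        using c v V by (force simp: dominator_coloring_def)
      \<comment> \<open>Recoloring can empty the trace on \<open>H\<close> of the class that \<open>v\<close> dominates, but only by
          turning each vertex of that trace into a singleton class, which \<open>v\<close> dominates too.\<close>
      then obtain y where y: "y \<in> color_class D c i" "y \<in> ?V"
        using False v by (auto simp: B_def lost_def)
      have trace: "x \<in> out_neighborhood H v" if "x \<in> color_class D c i" "x \<in> ?V" for x
        using that i v A by (auto simp: out_neighborhood_def)
      show ?thesis
      proof (cases "y \<in> w ` B")
        case True
        then show ?thesis using selected trace y by blast
      next
        case y_kept: False
        have "x \<in> color_class D c i" if "x \<in> color_class H c' i" for x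
        proof -
          have x: "x \<in> ?V" "c' x = c' y"
            using that y y_kept by (auto simp: color_class_def c'_def)
          then have "x \<notin> w ` B" using y_kept y singleton[of x y] by auto
          then show ?thesis using that V by (auto simp: color_class_def c'_def)
        qed
        moreover have "y \<in> color_class H c' i"
          using y y_kept by (simp add: color_class_def c'_def)
        ultimately show ?thesis
          using trace by (intro exI[of _ i]) (auto simp: color_class_def)
      qed
    qed
  qed
  moreover have "c' ` ?V \<subseteq> c ` pverts D"
    using V col_used by (auto simp: c'_def inv_into_into)
  ultimately show ?thesis using that by blast
qed

lemma dominator_chromatic_number_induced_le:
  assumes "pair_digraph D"
    and "pverts H \<subseteq> pverts D"
    and "parcs H = {(u, v) \<in> parcs D. u \<in> pverts H \<and> v \<in> pverts H}"
    and "\<And>u v x. \<lbrakk>u \<in> pverts H; v \<in> pverts H; x \<notin> pverts H;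
      (u, x) \<in> parcs D; (v, x) \<in> parcs D\<rbrakk> \<Longrightarrow> u = v"
  shows "dominator_chromatic_number H \<le> dominator_chromatic_number D"
proof -
  interpret pair_digraph D by fact
  obtain c where c: "dominator_coloring D c"
    and card: "card (c ` pverts D) = dominator_chromatic_number D"
    using dominator_chromatic_number_attained[OF assms(1)] .
  obtain c' where c': "dominator_coloring H c'" "c' ` pverts H \<subseteq> c ` pverts D"
    using dominator_coloring_induced[OF assms(2-4) c] .
  have "dominator_chromatic_number H \<le> card (c' ` pverts H)"
    using c'(1) by (rule dominator_chromatic_number_le)
  also have "\<dots> \<le> card (c ` pverts D)"
    using c'(2) pair_finite_verts by (intro card_mono) auto
  finally show ?thesis unfolding card .
qed

section \<open>Paths in trees\<close>

lemma (in pair_wf_digraph) vwalk_imp_awalk: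
  assumes "vwalk q (with_proj G)"
  shows "awalk (hd q) (vwalk_arcs q) (last q)" "awalk_verts (hd q) (vwalk_arcs q) = q"
  using assms
proof (induct q rule: vwalk_arcs.induct)
  case (3 x y xs)
  {
    case 1
    then have "vwalk (y # xs) (with_proj G)" "(x, y) \<in> parcs G" by (auto simp: vwalk_def)
    then show ?case using "3.hyps"(1) by (simp add: awalk_simps)
  next
    case 2
    then have "vwalk (y # xs) (with_proj G)" by (auto simp: vwalk_def)
    then show ?case using "3.hyps"(2) by simp
  }
qed (auto simp: vwalk_def awalk_simps)

text \<open>
  An arc joining the ends of a path closes a cycle. The bound on the length excludes an edge
  traversed back and forth, which the symmetric digraph \<open>G\<close> always contains.
\<close>

lemma tree_vpath_not_closed:
  assumes "undirected_tree G" "vpath q (with_proj G)" "length q \<ge> 3"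
  shows "(last q, hd q) \<notin> parcs G"
proof
  assume arc: "(last q, hd q) \<in> parcs G"
  interpret pair_graph G using assms(1) by (simp add: undirected_tree_def)
  have q: "vwalk q (with_proj G)" "distinct q" using assms(2) by auto
  \<comment> \<open>Starting the closed walk at \<open>last q\<close> makes \<open>q\<close> the tail of its vertex list, which is the part
      that has to be distinct.\<close>
  let ?p = "(last q, hd q) # vwalk_arcs q"
  have "cycle ?p"
    unfolding cycle_def using vwalk_imp_awalk[OF q(1)] q(2) arc
    by (intro exI[of _ "last q"]) (simp add: awalk_simps)
  moreover have "length ?p \<ge> 3"
    using assms(3) vwalk_length_simp[of q] unfolding vwalk_length_def by simp
  ultimately show False using assms(1) unfolding undirected_tree_def by blast
qed

lemma vpath_segment:
  assumes "vpath (xs @ ys @ zs) G" "ys \<noteq> []"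
  shows "vpath ys G"
  using assms vwalkI_append_r[of "ys @ zs" xs G] vwalkI_append_l[of ys zs G]
  by (auto simp: vpath_def)

lemma split_list_two:
  assumes "u \<in> set p" "v \<in> set p" "u \<noteq> v"
  obtains xs ys zs where "p = xs @ u # ys @ v # zs" | xs ys zs where "p = xs @ v # ys @ u # zs"
proof -
  obtain xs zs where p: "p = xs @ u # zs" using assms(1) by (meson split_list)
  then consider "v \<in> set xs" | "v \<in> set zs" using assms(2,3) by auto
  then show thesis
  proof cases
    case 1
    then obtain as bs where "xs = as @ v # bs" by (meson split_list)
    then show thesis using that(2) p by simp
  next
    case 2
    then obtain as bs where "zs = as @ v # bs" by (meson split_list)
    then show thesis using that(1) p by simp
  qed
qed

text \<open>
  An edge between two non-consecutive vertices of \<open>p\<close> would join the ends of the segment of \<open>p\<close>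
  between them.
\<close>

lemma tree_vpath_chord:
  assumes tree: "undirected_tree G" and p: "vpath p (with_proj G)"
    and "u \<in> set p" "v \<in> set p" "(u, v) \<in> parcs G"
  shows "(u, v) \<in> set (vwalk_arcs p) \<or> (v, u) \<in> set (vwalk_arcs p)"
proof -
  interpret pair_graph G using tree by (simp add: undirected_tree_def)
  have consecutive: "(a, b) \<in> set (vwalk_arcs p)"
    if split: "p = xs @ a # ys @ b # zs" and arc: "(b, a) \<in> parcs G" for a b xs ys zs
  proof -
    have "vpath (a # ys @ [b]) (with_proj G)"
      using p split vpath_segment[of xs "a # ys @ [b]" zs] by simp
    from tree_vpath_not_closed[OF tree this] have "ys = []"
      using arc by (cases ys) auto
    then show ?thesis
      using split in_set_vwalk_arcs_append1[of "(a, b)" xs "a # b # zs"] by simp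
  qed
  have "u \<noteq> v" using assms(5) pair_no_loops by fastforce
  with assms(3,4) show ?thesis
  proof (cases rule: split_list_two)
    case (1 xs ys zs)
    then show ?thesis using consecutive assms(5) arcs_symmetric by blast
  next
    case (2 xs ys zs)
    then show ?thesis using consecutive assms(5) by blast
  qed
qed

text \<open>
  The segment of \<open>p\<close> between two neighbors of \<open>x\<close>, prolonged by \<open>x\<close> at one end, would be a path
  whose ends are adjacent.
\<close>

lemma tree_vpath_outside_neighbor:
  assumes tree: "undirected_tree G" and p: "vpath p (with_proj G)"
    and uv: "u \<in> set p" "v \<in> set p" and x: "x \<notin> set p"
    and arcs: "(u, x) \<in> parcs G" "(v, x) \<in> parcs G"
  shows "u = v"
proof (rule ccontr)
  assume ne: "u \<noteq> v"
  interpret pair_graph G using tree by (simp add: undirected_tree_def)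
  have no_split: "p \<noteq> xs @ a # ys @ b # zs"
    if arc: "(a, x) \<in> parcs G" "(b, x) \<in> parcs G" for a b xs ys zs
  proof
    assume split: "p = xs @ a # ys @ b # zs"
    have "vpath (a # ys @ [b]) (with_proj G)"
      using p split vpath_segment[of xs "a # ys @ [b]" zs] by simp
    moreover have "(x, a) \<in> parcs G" "x \<in> pverts G"
      using arc(1) arcs_symmetric in_arcsD2 by auto
    ultimately have "vpath (x # a # ys @ [b]) (with_proj G)"
      using x split by (auto simp: vpath_def vwalk_def)
    from tree_vpath_not_closed[OF tree this] show False using arc by simp
  qed
  from uv ne show False
    by (cases rule: split_list_two) (use no_split arcs in blast)+
qed

theorem lemma7:
  fixes G T P :: "'a pair_pre_digraph" and p :: "'a vwalk"
  assumes "caterpillar G"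
    and "orientation T G"
    and "longest_path p G"
    and "P = path_subdigraph T p"
  shows "dominator_chromatic_number T \<ge> dominator_chromatic_number P"
proof (rule dominator_chromatic_number_induced_le)
  have tree: "undirected_tree G" using assms(1) by (simp add: caterpillar_def)
  have p: "vpath p (with_proj G)" using assms(3) by (simp add: longest_path_def)
  have T: "pverts T = pverts G" "parcs T \<subseteq> parcs G"
    using assms(2) by (auto simp: orientation_def)
  have P: "pverts P = set p" using assms(4) by (simp add: path_subdigraph_def)
  show "pair_digraph T"
    using tree assms(2) unfolding undirected_tree_def by (blast intro: orientation_pair_digraph)
  show "pverts P \<subseteq> pverts T" using p P T by (auto simp: vpath_def vwalk_def)
  show "parcs P = {(u, v) \<in> parcs T. u \<in> pverts P \<and> v \<in> pverts P}"
    using tree_vpath_chord[OF tree p] T P assms(4)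
    by (auto simp: path_subdigraph_def dest: arcs_in_vwalk_arcs)
  show "u = v" if "u \<in> pverts P" "v \<in> pverts P" "x \<notin> pverts P"
    "(u, x) \<in> parcs T" "(v, x) \<in> parcs T" for u v x
    using tree_vpath_outside_neighbor[OF tree p] that T P by blast
qed

end
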